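(* There are uncountably many transcendental entire functions $f:\mathbb{C}\to\mathbb{C}$ whose power series expansion $f(z)=\sum_{h=0}^{\infty} f_h z^h$ has rational coefficients ($f_h\in\mathbb{Q}$ for all $h\ge 0$) and such that, for all integers $j\geq 0$, $$f^{(j)}(\overline{\mathbb{Q}})\subseteq\overline{\mathbb{Q}}\quad\text{and}\quad \left(f^{(j)}\right)^{-1}(\overline{\mathbb{Q}})\subseteq\overline{\mathbb{Q}}.$$
   Context: $\overline{\mathbb{Q}}\subset\mathbb{C}$ denotes the set of all (complex) algebraic numbers. An analytic function $f$ over a domain $\Omega\subseteq\mathbb{C}$ is called transcendental (over $\mathbb{C}(z)$) if the only complex polynomial $P$ in two variables satisfying $P(z,f(z))=0$ for all $z\in\Omega$ is the zero polynomial; an entire function is transcendental if and only if it is not a polynomial function. $f^{(j)}$ denotes the derivative of order $j$ of $f$, with $f^{(0)}=f$. $\left(f^{(j)}\right)^{-1}(\overline{\mathbb{Q}})=\{z\in\mathbb{C}: f^{(j)}(z)\in\overline{\mathbb{Q}}\}$ denotes the inverse image (preimage) of $\overline{\mathbb{Q}}$ under $f^{(j)}$. *)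

theory Defs
  imports "HOL-Complex_Analysis.Complex_Analysis"
begin

definition Qbar :: "complex set" where
  "Qbar = {z. algebraic z}"

text \<open>
  A polynomial \<open>P(X, Y) = \<Sum>\<^sub>k a\<^sub>k(X) Y\<^sup>k\<close> in two variables over the complex numbers is represented
  by an element of \<open>complex poly poly\<close>, i.e. as a polynomial in \<open>Y\<close> with coefficients \<open>a\<^sub>k\<close>
  in \<open>complex poly\<close>. Substituting the constant polynomial \<open>w\<close> for \<open>Y\<close> and then evaluating
  at \<open>X = z\<close> gives \<open>P(z, w)\<close>.
\<close>
definition poly_eval2 :: "complex poly poly \<Rightarrow> complex \<Rightarrow> complex \<Rightarrow> complex" where
  "poly_eval2 P z w = poly (poly P [:w:]) z"

definition transcendental_on :: "(complex \<Rightarrow> complex) \<Rightarrow> complex set \<Rightarrow> bool" where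
  "transcendental_on f \<Omega> \<longleftrightarrow>
     (\<forall>P. (\<forall>z\<in>\<Omega>. poly_eval2 P z (f z) = 0) \<longrightarrow> P = 0)"

end

theory Submission
  imports Defs
begin

text \<open>
  Given any sequence \<open>g\<^sub>0, g\<^sub>1, \<dots>\<close> of functions, a member \<open>f\<close> of the set that differs from all of them is
  constructed, so the set cannot be countable. The function is a limit of polynomials \<open>F\<^sub>n\<close> with
  rational coefficients, where each \<open>F\<^sub>n\<^sub>+\<^sub>1 - F\<^sub>n\<close> is a tiny rational multiple of a polynomial that is
  divisible by a high power of every polynomial in a finite set \<open>\<D>\<^sub>n\<close> of constraints. This
  divisibility survives differentiation, so the multiple can be chosen so small that
  \<open>\<bar>f\<^sup>(\<^sup>j\<^sup>)(z) - F\<^sub>n\<^sup>(\<^sup>j\<^sup>)(z)\<bar> \<le> 2\<^sup>-\<^sup>n \<bar>d(z)\<bar>\<close> for all \<open>d \<in> \<D>\<^sub>n\<close>, \<open>j \<le> n\<close> and \<open>\<bar>z\<bar> \<le> n\<close>. This one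
  estimate gives both algebraicity properties. Let \<open>m\<^sub>0, m\<^sub>1, \<dots>\<close> enumerate the nonzero rational
  polynomials.

  \<^item> Images: let \<open>m\<^sub>k \<in> \<D>\<^sub>n\<close> for \<open>k \<le> n\<close>. If \<open>m\<^sub>k(\<alpha>) = 0\<close>, then the estimate forces
    \<open>f\<^sup>(\<^sup>j\<^sup>)(\<alpha>) = F\<^sub>n\<^sup>(\<^sup>j\<^sup>)(\<alpha>)\<close> for large \<open>n\<close>, and the value of a rational polynomial at an algebraic number is
    algebraic (\<open>algebraic_poly\<close>).

  \<^item> Preimages: let \<open>m\<^sub>k \<circ> F\<^sub>n\<^sup>(\<^sup>j\<^sup>) \<in> \<D>\<^sub>n\<close> for \<open>j, k \<le> n\<close>. Suppose that \<open>\<beta> = f\<^sup>(\<^sup>j\<^sup>)(z)\<close> is a root of \<open>m\<^sub>k\<close>, and write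
    \<open>x = F\<^sub>n\<^sup>(\<^sup>j\<^sup>)(z)\<close>. The estimate says that \<open>\<bar>\<beta> - x\<bar> \<le> 2\<^sup>-\<^sup>n \<bar>m\<^sub>k(x)\<bar>\<close>, while \<open>\<bar>m\<^sub>k(x)\<bar> \<le> L \<bar>x - \<beta>\<bar>\<close> near the root
    \<open>\<beta>\<close>. As soon as \<open>2\<^sup>-\<^sup>n L < 1\<close> this leaves only \<open>x = \<beta>\<close> (\<open>root_of_approximant\<close>), so \<open>z\<close> is a root of the
    rational polynomial \<open>m\<^sub>k \<circ> F\<^sub>n\<^sup>(\<^sup>j\<^sup>)\<close>, which is nonzero because the degree of \<open>F\<^sub>n\<close> exceeds \<open>n\<close>.

  The differences \<open>F\<^sub>n\<^sub>+\<^sub>1 - F\<^sub>n\<close> are also divisible by a power of the variable larger than the degree of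
  \<open>F\<^sub>n\<close>, so each \<open>F\<^sub>n\<close> is a partial sum of the Taylor series of \<open>f\<close>. Hence the Taylor coefficients are
  rational, infinitely many of them are nonzero, and the leading coefficient of \<open>F\<^sub>n\<^sub>+\<^sub>1\<close>, for which two
  values are available, can be chosen to differ from the corresponding coefficient of \<open>g\<^sub>n\<close>.
  Transcendence follows from Liouville's theorem: an entire function that is algebraic over the
  rational functions has polynomial growth and is therefore a polynomial.
\<close>

section \<open>Polynomials with rational coefficients\<close>

definition rational_poly :: "complex poly \<Rightarrow> bool" where
  "rational_poly p \<longleftrightarrow> (\<forall>i. coeff p i \<in> \<rat>)"

lemma rational_poly_0: "rational_poly 0" and rational_poly_1: "rational_poly 1"
  by (auto simp: rational_poly_def coeff_1)

lemma rational_poly_add: "rational_poly p \<Longrightarrow> rational_poly q \<Longrightarrow> rational_poly (p + q)"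
  by (simp add: rational_poly_def)

lemma rational_poly_mult: "rational_poly p \<Longrightarrow> rational_poly q \<Longrightarrow> rational_poly (p * q)"
  by (auto simp: rational_poly_def coeff_mult intro!: Rats_sum)

lemma rational_poly_power: "rational_poly p \<Longrightarrow> rational_poly (p ^ n)"
  by (induction n) (auto simp: rational_poly_1 intro: rational_poly_mult)

lemma rational_poly_prod: "(\<And>x. x \<in> A \<Longrightarrow> rational_poly (f x)) \<Longrightarrow> rational_poly (\<Prod>x\<in>A. f x)"
  by (induction A rule: infinite_finite_induct) (auto simp: rational_poly_1 intro: rational_poly_mult)

lemma rational_poly_smult: "c \<in> \<rat> \<Longrightarrow> rational_poly p \<Longrightarrow> rational_poly (smult c p)"
  by (simp add: rational_poly_def)

lemma rational_poly_monom: "c \<in> \<rat> \<Longrightarrow> rational_poly (monom c n)"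
  by (simp add: rational_poly_def)

lemma rational_poly_pCons_iff: "rational_poly (pCons a p) \<longleftrightarrow> a \<in> \<rat> \<and> rational_poly p"
  by (auto simp: rational_poly_def coeff_pCons split: nat.splits)

lemma rational_poly_pderiv: "rational_poly p \<Longrightarrow> rational_poly (pderiv p)"
  by (simp add: rational_poly_def coeff_pderiv del: of_nat_Suc)

lemma rational_poly_higher_pderiv: "rational_poly p \<Longrightarrow> rational_poly ((pderiv ^^ j) p)"
  by (induction j) (auto intro: rational_poly_pderiv)

lemma rational_poly_pcompose: "rational_poly p \<Longrightarrow> rational_poly q \<Longrightarrow> rational_poly (pcompose p q)"
  by (induction p)
     (auto simp: rational_poly_0 pcompose_pCons rational_poly_pCons_iff
           intro!: rational_poly_add rational_poly_mult)

lemma algebraic_iff_rational_poly: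
  "algebraic x \<longleftrightarrow> (\<exists>p. rational_poly p \<and> p \<noteq> 0 \<and> poly p x = 0)"
  by (simp add: algebraic_altdef rational_poly_def)

text \<open>
  A rational polynomial is determined by its finite list of coefficients.
\<close>
lemma countable_rational_poly: "countable {p. rational_poly p}"
proof -
  have "p \<in> range (\<lambda>xs. Poly (map of_rat xs))" if "rational_poly p" for p
  proof -
    have "\<forall>x\<in>set (coeffs p). \<exists>q. x = of_rat q"
      using that by (auto simp: rational_poly_def coeffs_def Rats_def)
    then have "coeffs p \<in> lists (range of_rat)"
      by blast
    then obtain xs where "coeffs p = map of_rat xs"
      by (auto simp: lists_image)
    then have "p = Poly (map of_rat xs)"
      by (metis Poly_coeffs)
    then show ?thesis
      by blast
  qed
  then have "{p. rational_poly p} \<subseteq> range (\<lambda>xs. Poly (map of_rat xs))"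
    by blast
  then show ?thesis
    by (rule countable_subset) auto
qed

section \<open>Rational polynomials map algebraic numbers to algebraic numbers\<close>
interpretation complex_over_rat: vector_space "\<lambda>q x. of_rat q * (x :: complex)"
  by unfold_locales (auto simp: of_rat_add of_rat_mult algebra_simps)


text \<open>
  The equation \<open>p(x) = 0\<close> expresses \<open>x\<^sup>d\<close>, where \<open>d\<close> is the degree of \<open>p\<close>, by lower powers of \<open>x\<close>;
  multiplication by a power of \<open>x\<close> then reduces every higher power as well. So the algebra
  \<open>\<rat>[x]\<close> has dimension at most \<open>d\<close> over \<open>\<rat>\<close>.
\<close>
lemma algebraic_powers_in_span:
  assumes "rational_poly p" "p \<noteq> 0" "poly p x = 0"
  shows "x ^ i \<in> complex_over_rat.span ((\<lambda>i. x ^ i) ` {..<degree p})"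
proof (induction i rule: less_induct)
  case (less i)
  let ?V = "complex_over_rat.span ((\<lambda>i. x ^ i) ` {..<degree p})"
  show ?case
  proof (cases "i < degree p")
    case True
    then show ?thesis by (auto intro: complex_over_rat.span_base)
  next
    case False
    have "poly p x = (\<Sum>k<degree p. coeff p k * x ^ k) + lead_coeff p * x ^ degree p"
      by (simp add: poly_altdef lessThan_Suc_atMost[symmetric])
    with assms have "lead_coeff p * x ^ degree p = - (\<Sum>k<degree p. coeff p k * x ^ k)"
      by (simp add: eq_neg_iff_add_eq_0 add.commute)
    then have "x ^ degree p = (\<Sum>k<degree p. - (coeff p k / lead_coeff p) * x ^ k)"
      using assms(2) by (simp add: sum_negf field_simps flip: sum_divide_distrib)
    moreover have "x ^ i = x ^ (i - degree p) * x ^ degree p"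
      using False by (simp add: power_add [symmetric])
    ultimately have eq: "x ^ i = (\<Sum>k<degree p. - (coeff p k / lead_coeff p) * x ^ (k + (i - degree p)))"
      by (simp only: sum_distrib_left power_add mult_ac)
    have "- (coeff p k / lead_coeff p) * x ^ (k + (i - degree p)) \<in> ?V" if "k < degree p" for k
    proof -
      have "- (coeff p k / lead_coeff p) \<in> \<rat>"
        using assms(1) by (simp add: rational_poly_def)
      then obtain q where q: "- (coeff p k / lead_coeff p) = of_rat q"
        by (auto simp: Rats_def)
      have "x ^ (k + (i - degree p)) \<in> ?V"
        using that False by (intro less) auto
      then show ?thesis
        unfolding q by (rule complex_over_rat.span_scale)
    qed
    then show ?thesis
      unfolding eq by (intro complex_over_rat.span_sum) auto
  qed
qed

text \<open>
  For \<open>y = F(x)\<close> the \<open>d + 1\<close> powers \<open>1, y, \<dots>, y\<^sup>d\<close> lie in a rational vector space of dimension at most \<open>d\<close>,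
  and a linear relation between them is a polynomial equation for \<open>y\<close>.
\<close>
lemma algebraic_poly:
  assumes "rational_poly F" "algebraic x"
  shows "algebraic (poly F x)"
proof -
  obtain p where p: "rational_poly p" "p \<noteq> 0" "poly p x = 0"
    using assms(2) by (auto simp: algebraic_iff_rational_poly)
  define T where "T = (\<lambda>i. x ^ i) ` {..<degree p}"
  define y where "y = poly F x"
  define S where "S = (\<lambda>i. y ^ i) ` {..degree p}"
  have pow: "y ^ i \<in> complex_over_rat.span T" for i
  proof -
    have "rational_poly (F ^ i)"
      by (rule rational_poly_power[OF assms(1)])
    have "y ^ i = (\<Sum>k\<le>degree (F ^ i). coeff (F ^ i) k * x ^ k)"
      unfolding y_def poly_power[symmetric] by (rule poly_altdef)
    also have "\<dots> \<in> complex_over_rat.span T"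
    proof (rule complex_over_rat.span_sum)
      fix k
      obtain q where q: "coeff (F ^ i) k = of_rat q"
        using \<open>rational_poly (F ^ i)\<close> by (auto simp: rational_poly_def Rats_def)
      show "coeff (F ^ i) k * x ^ k \<in> complex_over_rat.span T"
        unfolding q T_def
        by (intro complex_over_rat.span_scale algebraic_powers_in_span p)
    qed
    finally show ?thesis .
  qed
  \<comment> \<open>Linear dependence is a notion for sets, so coinciding powers of \<open>y\<close> need a separate case.\<close>
  show ?thesis
  proof (cases "inj_on (\<lambda>i. y ^ i) {..degree p}")
    case True
    have "complex_over_rat.dependent S"
    proof (rule ccontr)
      assume ind: "\<not> complex_over_rat.dependent S"
      have "S \<subseteq> complex_over_rat.span T"
        using pow by (auto simp: S_def)
      then have "card S \<le> card T"
        using complex_over_rat.independent_span_bound[OF _ ind] by (auto simp: T_def)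
      moreover have "card S = Suc (degree p)"
        using True by (simp add: S_def card_image)
      moreover have "card T \<le> degree p"
        unfolding T_def by (metis card_image_le card_lessThan finite_lessThan)
      ultimately show False by simp
    qed
    then obtain u where u: "\<exists>v\<in>S. u v \<noteq> 0" "(\<Sum>v\<in>S. of_rat (u v) * v) = 0"
      by (subst (asm) complex_over_rat.dependent_finite) (auto simp: S_def)
    define r :: "complex poly" where "r = (\<Sum>i\<le>degree p. monom (of_rat (u (y ^ i))) i)"
    have coeff_r: "coeff r i = (if i \<le> degree p then of_rat (u (y ^ i)) else 0)" for i
      by (simp add: r_def coeff_sum if_distrib sum.delta cong: if_cong)
    have "rational_poly r"
      by (simp add: rational_poly_def coeff_r)
    moreover have "r \<noteq> 0"
    proof -
      obtain i where "i \<le> degree p" "u (y ^ i) \<noteq> 0"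
        using u(1) by (auto simp: S_def)
      then have "coeff r i \<noteq> 0"
        by (simp add: coeff_r)
      then show ?thesis by auto
    qed
    moreover have "poly r y = (\<Sum>v\<in>S. of_rat (u v) * v)"
      unfolding S_def using True by (simp add: r_def poly_sum poly_monom sum.reindex)
    ultimately show ?thesis
      using u(2) by (auto simp: algebraic_iff_rational_poly y_def)
  next
    case False
    then obtain i k where ik: "y ^ i = y ^ k" "i \<noteq> k"
      by (auto simp: inj_on_def)
    define r :: "complex poly" where "r = monom 1 i + monom (-1) k"
    have "rational_poly r"
      unfolding r_def by (intro rational_poly_add rational_poly_monom) auto
    moreover have "coeff r i = 1"
      using ik by (simp add: r_def)
    then have "r \<noteq> 0"
      by auto
    moreover have "poly r y = 0"
      using ik by (simp add: r_def poly_monom)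
    ultimately show ?thesis
      by (auto simp: algebraic_iff_rational_poly y_def)
  qed
qed

section \<open>Derivatives and growth of polynomials\<close>

text \<open>
  By the product rule, each differentiation costs at most one factor \<open>p\<close>.
\<close>
lemma power_dvd_higher_pderiv:
  fixes p q :: "'a :: idom poly"
  assumes "p ^ (j + k) dvd q"
  shows "p ^ k dvd (pderiv ^^ j) q"
  using assms
proof (induction j arbitrary: q)
  case 0
  then show ?case by simp
next
  case (Suc j)
  then obtain r where r: "q = p ^ Suc (j + k) * r"
    by (metis add_Suc dvd_def)
  have "pderiv q = p ^ (j + k) * (p * pderiv r + smult (of_nat (Suc (j + k))) (r * pderiv p))"
    unfolding r pderiv_mult pderiv_power_Suc by (simp add: algebra_simps)
  then have "p ^ (j + k) dvd pderiv q"
    by (metis dvd_triv_left)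
  from Suc.IH[OF this] show ?case
    by (simp add: funpow_swap1)
qed

lemma higher_deriv_poly: "(deriv ^^ j) (poly p) = poly ((pderiv ^^ j) p)" for p :: "complex poly"
proof (induction j)
  case (Suc j)
  then show ?case
    by (auto intro!: DERIV_imp_deriv)
qed auto

lemma poly_higher_pderiv_0: "poly ((pderiv ^^ j) p) 0 = fact j * coeff p j" for p :: "complex poly"
  by (simp add: poly_0_coeff_0 coeff_higher_pderiv pochhammer_fact)

lemma poly_holomorphic: "poly p holomorphic_on A" for p :: "complex poly"
  by (auto intro!: holomorphic_intros simp: poly_altdef[abs_def])

lemma poly_le_degree_power:
  fixes p :: "complex poly"
  assumes "norm z \<ge> 1" "degree p \<le> K"
  shows "norm (poly p z) \<le> (\<Sum>i\<le>degree p. norm (coeff p i)) * norm z ^ K"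
proof -
  have "norm (poly p z) \<le> (\<Sum>i\<le>degree p. norm (coeff p i * z ^ i))"
    unfolding poly_altdef by (rule norm_sum)
  also have "\<dots> \<le> (\<Sum>i\<le>degree p. norm (coeff p i) * norm z ^ K)"
    using assms by (intro sum_mono) (auto simp: norm_mult norm_power intro!: mult_left_mono power_increasing)
  finally show ?thesis by (simp add: sum_distrib_right)
qed

lemma poly_bounded_below_at_infinity:
  fixes p :: "complex poly"
  assumes "p \<noteq> 0"
  obtains c R where "c > 0" "\<And>z. norm z \<ge> R \<Longrightarrow> c \<le> norm (poly p z)"
proof (cases p)
  case (pCons a q)
  show ?thesis
  proof (cases "q = 0")
    case True
    then show ?thesis
      using pCons assms that[of "norm a" 0] by auto
  next
    case False
    then have "degree p > 0"
      using pCons by simp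
    then have "eventually (\<lambda>z. 1 \<le> norm (poly p z)) at_infinity"
      using filterlim_poly_at_infinity[of p] by (simp add: filterlim_at_infinity[OF order_refl])
    then show ?thesis
      using that[of 1] by (auto simp: eventually_at_infinity)
  qed
qed

section \<open>Algebraic entire functions are polynomials\<close>

text \<open>
  Suppose \<open>a\<^sub>d f\<^sup>d + \<dots> + a\<^sub>0 = 0\<close> with polynomials \<open>a\<^sub>i\<close> and \<open>a\<^sub>d \<noteq> 0\<close>. Far from the origin \<open>\<bar>a\<^sub>d\<bar>\<close> is bounded
  below by some \<open>c > 0\<close> and every \<open>\<bar>a\<^sub>i\<bar>\<close> is at most \<open>C \<bar>z\<bar>\<^sup>K\<close>. Where \<open>\<bar>f\<bar> > 1\<close>, dividing the equation by \<open>f\<^sup>d\<^sup>-\<^sup>1\<close>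
  gives \<open>c \<bar>f(z)\<bar> \<le> d C \<bar>z\<bar>\<^sup>K\<close>, so \<open>f\<close> has polynomial growth.
\<close>
lemma entire_not_polynomial_imp_transcendental:
  assumes holf: "f holomorphic_on UNIV" and nz: "\<And>N. \<exists>h>N. (deriv ^^ h) f 0 \<noteq> 0"
  shows "transcendental_on f UNIV"
  unfolding transcendental_on_def
proof (intro allI impI)
  fix P assume P: "\<forall>z\<in>UNIV. poly_eval2 P z (f z) = 0"
  show "P = 0"
  proof (rule ccontr)
    assume "P \<noteq> 0"
    define d where "d = degree P"
    define K where "K = (MAX i\<in>{..d}. degree (coeff P i))"
    define C where "C = (\<Sum>i\<le>d. \<Sum>k\<le>degree (coeff P i). norm (coeff (coeff P i) k))"
    obtain c R where c: "c > 0" "\<And>z. norm z \<ge> R \<Longrightarrow> c \<le> norm (poly (lead_coeff P) z)"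
      using poly_bounded_below_at_infinity[of "lead_coeff P"] \<open>P \<noteq> 0\<close> by auto
    have C: "norm (poly (coeff P i) z) \<le> C * norm z ^ K" if "i \<le> d" "norm z \<ge> 1" for i z
    proof -
      have "norm (poly (coeff P i) z) \<le> (\<Sum>k\<le>degree (coeff P i). norm (coeff (coeff P i) k)) * norm z ^ K"
        using that by (intro poly_le_degree_power) (auto simp: K_def)
      also have "\<dots> \<le> C * norm z ^ K"
        unfolding C_def using that
        by (intro mult_right_mono member_le_sum[where f = "\<lambda>i. \<Sum>k\<le>degree (coeff P i). norm (coeff (coeff P i) k)"])
           (auto intro!: sum_nonneg)
      finally show ?thesis .
    qed
    have "C \<ge> 0"
      by (auto simp: C_def intro!: sum_nonneg)
    have eval: "(\<Sum>i\<le>d. poly (coeff P i) z * f z ^ i) = 0" for z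
      using P by (simp add: poly_eval2_def poly_altdef[of P] poly_sum d_def)
    have bound: "norm (f z) \<le> (1 + of_nat d * C / c) * norm z ^ K" if z: "norm z \<ge> max 1 R" for z
    proof (cases "norm (f z) \<le> 1")
      case True
      have "1 * 1 \<le> (1 + of_nat d * C / c) * norm z ^ K"
        using z c \<open>C \<ge> 0\<close> by (intro mult_mono one_le_power) auto
      with True show ?thesis by simp
    next
      case False
      define t where "t = norm (f z)"
      have t: "t > 1" using False by (simp add: t_def)
      have "(\<Sum>i<d. poly (coeff P i) z * f z ^ i) + poly (coeff P d) z * f z ^ d = 0"
        using eval[of z] by (simp add: lessThan_Suc_atMost[symmetric])
      then have eq: "poly (coeff P d) z * f z ^ d = - (\<Sum>i<d. poly (coeff P i) z * f z ^ i)"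
        by (simp add: eq_neg_iff_add_eq_0 add.commute)
      have "c * t ^ d \<le> norm (poly (coeff P d) z * f z ^ d)"
        unfolding norm_mult norm_power t_def using c z by (intro mult_right_mono) (auto simp: d_def)
      also have "\<dots> \<le> (\<Sum>i<d. norm (poly (coeff P i) z * f z ^ i))"
        unfolding eq norm_minus_cancel by (rule norm_sum)
      also have "\<dots> \<le> (\<Sum>i<d. C * norm z ^ K * t ^ (d - 1))"
        unfolding norm_mult norm_power t_def[symmetric] using t z \<open>C \<ge> 0\<close>
        by (intro sum_mono mult_mono C power_increasing) auto
      finally have le: "c * t ^ d \<le> of_nat d * (C * norm z ^ K * t ^ (d - 1))"
        by simp
      have "d > 0"
        using le c(1) by (cases d) auto
      then have "t ^ d = t * t ^ (d - 1)"
        by (simp add: power_eq_if)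
      then have "(c * t) * t ^ (d - 1) \<le> (of_nat d * C * norm z ^ K) * t ^ (d - 1)"
        using le by (simp add: mult_ac)
      then have "c * t \<le> of_nat d * C * norm z ^ K"
        using t by (simp add: mult_le_cancel_right)
      then have "t \<le> of_nat d * C / c * norm z ^ K"
        using c(1) by (simp add: field_simps)
      also have "\<dots> \<le> (1 + of_nat d * C / c) * norm z ^ K"
        by (intro mult_right_mono) auto
      finally show ?thesis by (simp add: t_def)
    qed
    define p where "p = (\<Sum>k\<le>K. monom ((deriv ^^ k) f 0 / fact k) k)"
    have "f z = poly p z" for z
      using Liouville_polynomial[where A = "max 1 R" and \<xi> = z, OF holf bound]
      by (simp add: p_def poly_sum poly_monom)
    then have "f = poly p"
      by blast
    obtain h where h: "h > K" "(deriv ^^ h) f 0 \<noteq> 0"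
      using nz by blast
    have "coeff p h = 0"
      using h(1) by (simp add: p_def coeff_sum)
    then show False
      using h(2) unfolding \<open>f = poly p\<close> higher_deriv_poly poly_higher_pderiv_0 by simp
  qed
qed


section \<open>Approximation of an entire function by constrained polynomials\<close>

text \<open>
  The perturbation is a small rational multiple of \<open>Q = X\<^sup>N W\<^sup>n\<^sup>+\<^sup>1\<close>, where \<open>W\<close> is the product of all
  constraints and \<open>N\<close> is one more than the degree of \<open>F\<close>. The factor \<open>X\<^sup>N\<close> protects the coefficients
  of \<open>F\<close>. The exponent \<open>n + 1\<close> makes \<open>Q\<^sup>(\<^sup>j\<^sup>)\<close> divisible by each constraint \<open>d\<close> for \<open>j \<le> n\<close>, so that
  \<open>Q\<^sup>(\<^sup>j\<^sup>) / d\<close> is bounded on the disc. The freedom in the size of the multiple is used to avoid the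
  leading coefficient that \<open>b\<close> forbids in the degree of the result.
\<close>
lemma rational_perturbation:
  assumes fin: "finite \<D>" and nz: "0 \<notin> \<D>" and rat: "\<And>d. d \<in> \<D> \<Longrightarrow> rational_poly d"
    and F: "rational_poly F" and \<delta>: "\<delta> > 0"
  obtains G where "rational_poly G" "degree F < degree G"
    "\<And>i. i \<le> degree F \<Longrightarrow> coeff G i = coeff F i" "lead_coeff G \<noteq> b (degree G)"
    "\<And>d j z. d \<in> \<D> \<Longrightarrow> j \<le> n \<Longrightarrow> norm z \<le> r \<Longrightarrow>
       norm (poly ((pderiv ^^ j) G) z - poly ((pderiv ^^ j) F) z) \<le> \<delta> * norm (poly d z)"
proof -
  define W where "W = (\<Prod>d\<in>\<D>. d)"
  define Q where "Q = monom 1 (Suc (degree F)) * W ^ Suc n"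
  have "W \<noteq> 0"
    using fin nz by (auto simp: W_def)
  then have Q: "Q \<noteq> 0" "rational_poly Q" "degree Q > degree F"
    unfolding Q_def W_def using rat
    by (auto intro!: rational_poly_mult rational_poly_monom rational_poly_power rational_poly_prod
             simp: degree_mult_eq degree_monom_eq monom_eq_0_iff simp del: power_Suc)
  have low: "coeff Q i = 0" if "i \<le> degree F" for i
    using that by (simp add: Q_def coeff_monom_mult)
  have "\<exists>B. \<forall>z\<in>cball 0 r. norm (poly ((pderiv ^^ j) Q) z) \<le> B * norm (poly d z)"
    if "d \<in> \<D>" "j \<le> n" for d j
  proof -
    have "d dvd W"
      unfolding W_def using fin that(1) by (rule dvd_prodI)
    then have "d ^ Suc n dvd Q"
      unfolding Q_def by (intro dvd_mult dvd_power_same)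
    then have "d ^ Suc j dvd Q"
      using that(2) by (meson Suc_le_mono dvd_trans le_imp_power_dvd)
    then have "d ^ 1 dvd (pderiv ^^ j) Q"
      by (intro power_dvd_higher_pderiv) simp
    then obtain e where e: "(pderiv ^^ j) Q = d * e"
      by auto
    have "compact (poly e ` cball 0 r)"
      by (intro compact_continuous_image continuous_intros compact_cball)
    then have "bounded (poly e ` cball 0 r)"
      by (rule compact_imp_bounded)
    then obtain B where "\<And>z. z \<in> cball 0 r \<Longrightarrow> norm (poly e z) \<le> B"
      unfolding bounded_iff by blast
    then show ?thesis
      unfolding e poly_mult norm_mult mult.commute[of "norm (poly d _)"]
      by (intro exI[of _ B] ballI mult_right_mono) auto
  qed
  then obtain B where B: "\<And>d j z. d \<in> \<D> \<Longrightarrow> j \<le> n \<Longrightarrow> norm z \<le> r \<Longrightarrow>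
      norm (poly ((pderiv ^^ j) Q) z) \<le> B d j * norm (poly d z)"
    unfolding mem_cball_0 Ball_def by metis
  define M where "M = 1 + (\<Sum>d\<in>\<D>. \<Sum>j\<le>n. \<bar>B d j\<bar>)"
  have M0: "M > 0"
    unfolding M_def by (intro add_pos_nonneg sum_nonneg) auto
  have M: "B d j \<le> M" if "d \<in> \<D>" "j \<le> n" for d j
  proof -
    have "B d j \<le> (\<Sum>j\<le>n. \<bar>B d j\<bar>)"
      using member_le_sum[of j "{..n}" "\<lambda>j. \<bar>B d j\<bar>"] that by auto
    also have "\<dots> \<le> (\<Sum>d\<in>\<D>. \<Sum>j\<le>n. \<bar>B d j\<bar>)"
      using that fin by (intro member_le_sum[where f = "\<lambda>d. \<Sum>j\<le>n. \<bar>B d j\<bar>"] sum_nonneg) auto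
    finally show ?thesis by (simp add: M_def)
  qed
  obtain q :: rat where q: "0 < real_of_rat q" "real_of_rat q < \<delta> / M"
    using of_rat_dense[of 0 "\<delta> / M"] M0 \<delta> by auto
  \<comment> \<open>At most one of two different multiples of \<open>Q\<close> has the forbidden leading coefficient.\<close>
  have "\<exists>s\<in>{q, q / 2}. of_rat s * lead_coeff Q \<noteq> b (degree Q)"
    using Q(1) q(1) by (cases "of_rat q * lead_coeff Q = b (degree Q)") (auto simp: of_rat_divide)
  then obtain s where s: "s = q \<or> s = q / 2" "of_rat s * lead_coeff Q \<noteq> b (degree Q)"
    by blast
  have s_pos: "s > 0" and s_le_q: "real_of_rat s \<le> real_of_rat q"
    using s(1) q by (auto simp: of_rat_less_eq)
  have s_le: "real_of_rat s \<le> \<delta> / M"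
    using s_le_q q(2) by linarith
  have "complex_of_rat s = complex_of_real (of_rat s)"
    by (cases s) (simp add: Fract_of_int_quotient of_rat_divide)
  then have norm_s: "norm (complex_of_rat s) = real_of_rat s"
    using s_pos by simp
  define P where "P = smult (of_rat s) Q"
  have P: "degree P = degree Q" "lead_coeff P = of_rat s * lead_coeff Q"
    using s_pos by (auto simp: P_def)
  have deg: "degree (F + P) = degree Q"
    using P(1) Q(3) by (simp add: degree_add_eq_right)
  show ?thesis
  proof (rule that[of "F + P"])
    show "rational_poly (F + P)"
      unfolding P_def by (intro rational_poly_add rational_poly_smult F Q) auto
    show "degree F < degree (F + P)"
      using deg Q(3) by simp
    show "coeff (F + P) i = coeff F i" if "i \<le> degree F" for i
      using low[OF that] by (simp add: P_def)
    show "lead_coeff (F + P) \<noteq> b (degree (F + P))"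
      unfolding deg using s(2) Q(3) by (simp add: P_def coeff_eq_0)
    fix d j and z :: complex assume *: "d \<in> \<D>" "j \<le> n" "norm z \<le> r"
    have "norm (poly ((pderiv ^^ j) (F + P)) z - poly ((pderiv ^^ j) F) z)
        = real_of_rat s * norm (poly ((pderiv ^^ j) Q) z)"
      using s_pos norm_s
      by (simp add: P_def higher_pderiv_add higher_pderiv_smult norm_mult)
    also have "\<dots> \<le> (\<delta> / M) * (M * norm (poly d z))"
    proof (intro mult_mono s_le)
      show "norm (poly ((pderiv ^^ j) Q) z) \<le> M * norm (poly d z)"
        using B[OF *] M[OF *(1,2)] by (meson mult_right_mono norm_ge_zero order_trans)
    qed (use M0 \<delta> in auto)
    also have "\<dots> = \<delta> * norm (poly d z)"
      using M0 by simp
    finally show "norm (poly ((pderiv ^^ j) (F + P)) z - poly ((pderiv ^^ j) F) z) \<le> \<delta> * norm (poly d z)" .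
  qed
qed

text \<open>
  Constraints are never dropped, so a constraint \<open>d \<in> \<D> n\<close> controls all later steps, and the errors
  \<open>2\<^sup>-\<^sup>(\<^sup>i\<^sup>+\<^sup>1\<^sup>) \<bar>d\<bar>\<close> for \<open>i \<ge> n\<close> add up to \<open>2\<^sup>-\<^sup>n \<bar>d\<bar>\<close>. The constraint \<open>1\<close> makes the convergence locally uniform;
  by Weierstrass' theorem the limit is entire and the derivatives converge too.
\<close>
lemma entire_limit_of_controlled_polynomials:
  fixes F :: "nat \<Rightarrow> complex poly" and \<D> :: "nat \<Rightarrow> complex poly set"
  assumes mono: "\<And>n. \<D> n \<subseteq> \<D> (Suc n)" and one: "1 \<in> \<D> 0"
    and step: "\<And>n d j z. d \<in> \<D> n \<Longrightarrow> j \<le> n \<Longrightarrow> norm z \<le> real n \<Longrightarrow>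
      norm (poly ((pderiv ^^ j) (F (Suc n))) z - poly ((pderiv ^^ j) (F n)) z)
        \<le> (1/2) ^ Suc n * norm (poly d z)"
  obtains f where "f holomorphic_on UNIV"
    "\<And>j z. (\<lambda>n. poly ((pderiv ^^ j) (F n)) z) \<longlonglongrightarrow> (deriv ^^ j) f z"
    "\<And>n d j z. d \<in> \<D> n \<Longrightarrow> j \<le> n \<Longrightarrow> norm z \<le> real n \<Longrightarrow>
      norm ((deriv ^^ j) f z - poly ((pderiv ^^ j) (F n)) z) \<le> (1/2) ^ n * norm (poly d z)"
proof -
  have mono': "\<D> m \<subseteq> \<D> n" if "m \<le> n" for m n
    using lift_Suc_mono_le[of \<D>, OF mono that] .
  have diff: "norm (poly ((pderiv ^^ j) (F (n + k))) z - poly ((pderiv ^^ j) (F n)) z)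
      \<le> ((1/2) ^ n - (1/2) ^ (n + k)) * norm (poly d z)"
    if "d \<in> \<D> n" "j \<le> n" "norm z \<le> real n" for n k d j z
  proof (induction k)
    case (Suc k)
    let ?p = "\<lambda>m. poly ((pderiv ^^ j) (F m)) z"
    have "d \<in> \<D> (n + k)"
      using mono'[of n "n + k"] that by auto
    then have "norm (?p (Suc (n + k)) - ?p (n + k)) \<le> (1/2) ^ Suc (n + k) * norm (poly d z)"
      using that by (intro step) auto
    with Suc have "norm (?p (n + Suc k) - ?p n)
        \<le> (1/2) ^ Suc (n + k) * norm (poly d z) + ((1/2) ^ n - (1/2) ^ (n + k)) * norm (poly d z)"
      using norm_triangle_ineq[of "?p (Suc (n + k)) - ?p (n + k)" "?p (n + k) - ?p n"] by simp
    also have "\<dots> = ((1/2) ^ n - (1/2) ^ (n + Suc k)) * norm (poly d z)"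
      by (simp add: field_simps)
    finally show ?case .
  qed auto
  define f where "f z = lim (\<lambda>n. poly (F n) z)" for z
  have unif: "norm (poly (F m) z - poly (F n) z) \<le> (1/2) ^ n" if "norm z \<le> real n" "n \<le> m" for m n z
  proof -
    have "1 \<in> \<D> n"
      using one mono'[of 0 n] by auto
    from diff[OF this, of 0 z "m - n"] that show ?thesis
      by simp (smt (verit) zero_le_divide_1_iff zero_le_power)
  qed
  have conv: "(\<lambda>n. poly (F n) z) \<longlonglongrightarrow> f z" for z
  proof -
    have "Cauchy (\<lambda>n. poly (F n) z)"
    proof (rule metric_CauchyI)
      fix e :: real assume e: "e > 0"
      obtain N0 where N0: "(1/2) ^ N0 < e / 2"
        using real_arch_pow_inv[of "e / 2" "1 / 2"] e by auto
      obtain N where N: "N \<ge> N0" "norm z \<le> real N"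
        by (metis real_arch_simple max.bounded_iff of_nat_le_iff max.cobounded1 nle_le order_trans)
      have "(1/2 :: real) ^ N \<le> (1/2) ^ N0"
        using N(1) by (intro power_decreasing) auto
      then have "dist (poly (F m) z) (poly (F N) z) < e / 2" if "m \<ge> N" for m
        using unif[OF N(2) that] N0 unfolding dist_norm by linarith
      then show "\<exists>M. \<forall>m\<ge>M. \<forall>n\<ge>M. dist (poly (F m) z) (poly (F n) z) < e"
        by (metis dist_commute dist_triangle_half_r)
    qed
    then show ?thesis
      by (simp add: f_def Cauchy_convergent_iff convergent_LIMSEQ_iff)
  qed
  have ulim: "uniform_limit (ball 0 R) (\<lambda>n. poly (F n)) f sequentially" for R
  proof (rule uniform_limitI)
    fix e :: real assume e: "e > 0"
    have "(\<lambda>n. (1/2 :: real) ^ n) \<longlonglongrightarrow> 0"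
      by (rule LIMSEQ_power_zero) simp
    then have "eventually (\<lambda>n. (1/2) ^ n < e) sequentially"
      using e by (rule order_tendstoD)
    moreover have "eventually (\<lambda>n. R \<le> real n) sequentially"
      using filterlim_real_sequentially by (simp add: filterlim_at_top)
    ultimately show "eventually (\<lambda>n. \<forall>z\<in>ball 0 R. dist (poly (F n) z) (f z) < e) sequentially"
    proof eventually_elim
      case (elim n)
      show ?case
      proof
        fix z :: complex assume "z \<in> ball 0 R"
        then have z: "norm z \<le> real n"
          using elim by simp
        have "eventually (\<lambda>m. norm (poly (F m) z - poly (F n) z) \<le> (1/2) ^ n) sequentially"
          using eventually_ge_at_top[of n] by eventually_elim (use z unif in auto)
        then have "norm (f z - poly (F n) z) \<le> (1/2) ^ n"
          using tendsto_norm[OF tendsto_diff[OF conv tendsto_const]]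
          by (intro tendsto_upperbound[where F = sequentially]) auto
        then show "dist (poly (F n) z) (f z) < e"
          using elim by (simp add: dist_norm norm_minus_commute)
      qed
    qed
  qed
  have deriv_lim: "(\<lambda>n. poly ((pderiv ^^ j) (F n)) z) \<longlonglongrightarrow> (deriv ^^ j) f z" for j z
    using higher_deriv_complex_uniform_limit[OF ulim[of "norm z + 1"], of z j]
    by (simp add: higher_deriv_poly poly_holomorphic)
  show ?thesis
  proof (rule that)
    show "f holomorphic_on UNIV"
    proof (rule holomorphic_uniform_sequence)
      fix z :: complex
      have "cball z 1 \<subseteq> ball 0 (norm z + 2)"
        by (auto simp: dist_norm) (smt (verit) norm_minus_commute norm_triangle_sub)
      then show "\<exists>d>0. cball z d \<subseteq> UNIV \<and> uniform_limit (cball z d) (\<lambda>n. poly (F n)) f sequentially"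
        using uniform_limit_on_subset[OF ulim] by (intro exI[of _ 1]) auto
    qed (auto intro: poly_holomorphic)
    show "norm ((deriv ^^ j) f z - poly ((pderiv ^^ j) (F n)) z) \<le> (1/2) ^ n * norm (poly d z)"
      if *: "d \<in> \<D> n" "j \<le> n" "norm z \<le> real n" for n d j z
    proof (rule tendsto_upperbound[where F = sequentially])
      show "(\<lambda>m. norm (poly ((pderiv ^^ j) (F m)) z - poly ((pderiv ^^ j) (F n)) z))
          \<longlonglongrightarrow> norm ((deriv ^^ j) f z - poly ((pderiv ^^ j) (F n)) z)"
        by (intro tendsto_intros deriv_lim)
      show "eventually (\<lambda>m. norm (poly ((pderiv ^^ j) (F m)) z - poly ((pderiv ^^ j) (F n)) z)
          \<le> (1/2) ^ n * norm (poly d z)) sequentially"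
        using eventually_ge_at_top[of n]
      proof eventually_elim
        case (elim m)
        have "((1/2) ^ n - (1/2) ^ m) * norm (poly d z) \<le> (1/2) ^ n * norm (poly d z)"
          by (intro mult_right_mono) auto
        with diff[OF *, of "m - n"] elim show ?case
          by simp
      qed
    qed auto
  qed (rule deriv_lim)
qed


section \<open>Approximants that attain an algebraic value\<close>
lemma poly_le_dist_to_root:
  fixes p :: "complex poly"
  assumes "poly p \<beta> = 0"
  obtains L where "\<And>x. norm (x - \<beta>) \<le> 1 \<Longrightarrow> norm (poly p x) \<le> L * norm (x - \<beta>)"
proof -
  obtain q where q: "p = [:- \<beta>, 1:] * q"
    using assms by (auto simp: poly_eq_0_iff_dvd)
  have "compact (poly q ` cball \<beta> 1)"
    by (intro compact_continuous_image continuous_intros compact_cball)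
  then have "bounded (poly q ` cball \<beta> 1)"
    by (rule compact_imp_bounded)
  then obtain L where L: "\<And>x. x \<in> cball \<beta> 1 \<Longrightarrow> norm (poly q x) \<le> L"
    unfolding bounded_iff by blast
  show ?thesis
  proof (rule that[of L])
    fix x assume "norm (x - \<beta>) \<le> 1"
    then have "norm (poly q x) \<le> L"
      by (intro L) (simp add: dist_norm norm_minus_commute)
    moreover have px: "poly p x = (x - \<beta>) * poly q x"
      by (simp add: q algebra_simps)
    ultimately show "norm (poly p x) \<le> L * norm (x - \<beta>)"
      unfolding px norm_mult mult.commute[of L] by (intro mult_left_mono) auto
  qed
qed

text \<open>
  Near its root \<open>\<beta>\<close> the polynomial \<open>p\<close> is at most \<open>L \<bar>x - \<beta>\<bar>\<close>. An error bound
  \<open>\<bar>\<beta> - x\<bar> \<le> 2\<^sup>-\<^sup>n \<bar>p(x)\<bar>\<close> with \<open>2\<^sup>-\<^sup>n L < 1\<close> therefore contradicts itself unless \<open>x = \<beta>\<close>. Applied with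
  \<open>\<beta> = f\<^sup>(\<^sup>j\<^sup>)(z)\<close> and \<open>x n = F\<^sub>n\<^sup>(\<^sup>j\<^sup>)(z)\<close>, this does without a count of the solutions of \<open>f\<^sup>(\<^sup>j\<^sup>) = \<beta>\<close> by
  Rouche's theorem.
\<close>
lemma root_of_approximant:
  fixes p :: "complex poly" and x :: "nat \<Rightarrow> complex"
  assumes "poly p \<beta> = 0" and x: "x \<longlonglongrightarrow> \<beta>"
    and le: "eventually (\<lambda>n. norm (\<beta> - x n) \<le> (1/2) ^ n * norm (poly p (x n))) sequentially"
  shows "eventually (\<lambda>n. poly p (x n) = 0) sequentially"
proof -
  obtain L where L: "\<And>x. norm (x - \<beta>) \<le> 1 \<Longrightarrow> norm (poly p x) \<le> L * norm (x - \<beta>)"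
    using poly_le_dist_to_root[OF assms(1)] by blast
  have near: "eventually (\<lambda>n. dist (x n) \<beta> < 1) sequentially"
    using x by (rule tendstoD) simp
  have "(\<lambda>n. (1/2 :: real) ^ n * L) \<longlonglongrightarrow> 0 * L"
    by (intro tendsto_intros LIMSEQ_power_zero) simp
  then have "eventually (\<lambda>n. (1/2) ^ n * L < 1) sequentially"
    by (rule order_tendstoD) simp
  with near le show ?thesis
  proof eventually_elim
    case (elim n)
    have "norm (x n - \<beta>) \<le> (1/2) ^ n * norm (poly p (x n))"
      using elim(2) by (simp add: norm_minus_commute)
    also have "\<dots> \<le> (1/2) ^ n * (L * norm (x n - \<beta>))"
      using elim(1) by (intro mult_left_mono L) (auto simp: dist_norm)
    finally have "norm (x n - \<beta>) * (1 - (1/2) ^ n * L) \<le> 0"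
      by (simp add: algebra_simps)
    then have "norm (x n - \<beta>) \<le> 0"
      using elim(3) by (simp add: mult_le_0_iff)
    then show ?case
      using assms(1) by simp
  qed
qed

section \<open>The diagonal construction\<close>
lemma nonzero_rational_polys_sequence:
  "\<exists>m :: nat \<Rightarrow> complex poly. range m = {p. rational_poly p \<and> p \<noteq> 0}"
proof -
  have "countable {p. rational_poly p \<and> p \<noteq> 0}"
    by (rule countable_subset[OF _ countable_rational_poly]) auto
  moreover have "1 \<in> {p. rational_poly p \<and> p \<noteq> 0}"
    by (simp add: rational_poly_1)
  ultimately show ?thesis
    by (metis range_from_nat_into empty_iff)
qed

text \<open>
  The approximants \<open>F n\<close> are built together with the constraints \<open>\<D> n\<close>, since the constraint
  \<open>m\<^sub>k \<circ> F\<^sub>n\<^sup>(\<^sup>j\<^sup>)\<close> depends on the approximant just found and binds all later ones. The values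
  \<open>b n\<close> are the leading coefficients to avoid at step \<open>n\<close>, as a function of the degree, which is
  known only once the step has been taken.
\<close>
lemma constrained_polynomial_sequence:
  fixes m :: "nat \<Rightarrow> complex poly" and b :: "nat \<Rightarrow> nat \<Rightarrow> complex"
  assumes m: "\<And>k. rational_poly (m k) \<and> m k \<noteq> 0"
  obtains F \<D> where
    "\<And>n. rational_poly (F n)" "\<And>n. n < degree (F n)" "\<And>n. degree (F n) < degree (F (Suc n))"
    "\<And>n i. i \<le> degree (F n) \<Longrightarrow> coeff (F (Suc n)) i = coeff (F n) i"
    "\<And>n. lead_coeff (F (Suc n)) \<noteq> b n (degree (F (Suc n)))"
    "\<And>n. \<D> n \<subseteq> \<D> (Suc n)" "1 \<in> \<D> 0"
    "\<And>n k. k \<le> n \<Longrightarrow> m k \<in> \<D> n"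
    "\<And>n j k. j \<le> n \<Longrightarrow> k \<le> n \<Longrightarrow> pcompose (m k) ((pderiv ^^ j) (F n)) \<in> \<D> n"
    "\<And>n d j z. d \<in> \<D> n \<Longrightarrow> j \<le> n \<Longrightarrow> norm z \<le> real n \<Longrightarrow>
      norm (poly ((pderiv ^^ j) (F (Suc n))) z - poly ((pderiv ^^ j) (F n)) z)
        \<le> (1/2) ^ Suc n * norm (poly d z)"
proof -
  define C where "C n F = m ` {..n} \<union> (\<lambda>(j, k). pcompose (m k) ((pderiv ^^ j) F)) ` ({..n} \<times> {..n})"
    for n and F :: "complex poly"
  define admissible where "admissible n = (\<lambda>(F, \<D>). rational_poly F \<and> n < degree F \<and> finite \<D> \<and>
      (\<forall>d\<in>\<D>. rational_poly d \<and> d \<noteq> 0) \<and> 1 \<in> \<D> \<and> C n F \<subseteq> \<D>)" for n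
  define step where "step n = (\<lambda>(F, \<D>) (G, \<E>). degree F < degree G \<and>
      (\<forall>i\<le>degree F. coeff G i = coeff F i) \<and> lead_coeff G \<noteq> b n (degree G) \<and> \<D> \<subseteq> \<E> \<and>
      (\<forall>d\<in>\<D>. \<forall>j\<le>n. \<forall>z. norm z \<le> real n \<longrightarrow>
        norm (poly ((pderiv ^^ j) G) z - poly ((pderiv ^^ j) F) z) \<le> (1/2) ^ Suc n * norm (poly d z)))" for n
  have C: "finite (C n F)" "\<And>d. d \<in> C n F \<Longrightarrow> rational_poly d \<and> d \<noteq> 0"
    if "rational_poly F" "n < degree F" for n F
  proof -
    \<comment> \<open>The degree bound keeps \<open>F\<^sup>(\<^sup>j\<^sup>)\<close> nonconstant; a constant one could be a root of \<open>m\<^sub>k\<close>.\<close>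
    have "pcompose (m k) ((pderiv ^^ j) F) \<noteq> 0" if "j \<le> n" for j k
      using m[of k] \<open>n < degree F\<close> that by (simp add: pcompose_eq_0_iff degree_higher_pderiv)
    then show "\<And>d. d \<in> C n F \<Longrightarrow> rational_poly d \<and> d \<noteq> 0"
      using m that(1) by (auto simp: C_def intro!: rational_poly_pcompose rational_poly_higher_pderiv)
  qed (simp add: C_def)
  have "\<exists>s. \<forall>n. admissible n (s n) \<and> step n (s n) (s (Suc n))"
  proof (rule dependent_nat_choice)
    have "rational_poly (monom 1 1)" "0 < degree (monom 1 1 :: complex poly)"
      by (auto intro: rational_poly_monom simp: degree_monom_eq)
    note F0 = this C[OF this]
    have "admissible 0 (monom 1 1, insert 1 (C 0 (monom 1 1)))"
      unfolding admissible_def using F0 by (auto simp: rational_poly_1)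
    then show "\<exists>s. admissible 0 s" ..
  next
    fix s n assume s: "admissible n s"
    obtain F \<D> where FD: "s = (F, \<D>)"
      by fastforce
    have F: "rational_poly F" "n < degree F" "finite \<D>" "0 \<notin> \<D>" "\<And>d. d \<in> \<D> \<Longrightarrow> rational_poly d"
      "1 \<in> \<D>" "\<And>d. d \<in> \<D> \<Longrightarrow> d \<noteq> 0"
      using s by (auto simp: FD admissible_def)
    have "(1/2 :: real) ^ Suc n > 0"
      by simp
    from rational_perturbation[OF F(3-5,1) this, of "b n" n "real n"] obtain G where
      G: "rational_poly G" "degree F < degree G" "\<And>i. i \<le> degree F \<Longrightarrow> coeff G i = coeff F i"
        "lead_coeff G \<noteq> b n (degree G)"
        "\<And>d j z. d \<in> \<D> \<Longrightarrow> j \<le> n \<Longrightarrow> norm z \<le> real n \<Longrightarrow>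
          norm (poly ((pderiv ^^ j) G) z - poly ((pderiv ^^ j) F) z) \<le> (1/2) ^ Suc n * norm (poly d z)"
      by metis
    have "Suc n < degree G"
      using F(2) G(2) by simp
    note CG = C[OF G(1) this]
    have "admissible (Suc n) (G, \<D> \<union> C (Suc n) G)"
      unfolding admissible_def using F G(1) \<open>Suc n < degree G\<close> CG by auto
    moreover have "step n s (G, \<D> \<union> C (Suc n) G)"
      unfolding step_def FD using G by auto
    ultimately show "\<exists>s'. admissible (Suc n) s' \<and> step n s s'"
      by blast
  qed
  then obtain s where s: "\<And>n. admissible n (s n)" "\<And>n. step n (s n) (s (Suc n))"
    by blast
  show ?thesis
  proof (rule that[of "\<lambda>n. fst (s n)" "\<lambda>n. snd (s n)"])
    show "m k \<in> snd (s n)" if "k \<le> n" for n k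
      using s(1)[of n] that by (auto simp: admissible_def C_def)
    show "pcompose (m k) ((pderiv ^^ j) (fst (s n))) \<in> snd (s n)" if "j \<le> n" "k \<le> n" for n j k
      using s(1)[of n] that by (auto simp: admissible_def C_def)
  qed (use s in \<open>auto simp: admissible_def step_def case_prod_unfold\<close>)
qed

text \<open>
  With \<open>b n\<close> taken to be the Taylor coefficients of \<open>g n\<close>, the leading coefficient of \<open>F (Suc n)\<close>
  is a Taylor coefficient of the limit \<open>f\<close> that separates \<open>f\<close> from \<open>g n\<close>.
\<close>
lemma entire_function_outside_sequence:
  fixes g :: "nat \<Rightarrow> complex \<Rightarrow> complex"
  obtains f where "f holomorphic_on UNIV" "transcendental_on f UNIV"
    "\<And>h. (deriv ^^ h) f 0 / fact h \<in> \<rat>"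
    "\<And>j. (deriv ^^ j) f ` Qbar \<subseteq> Qbar" "\<And>j. (deriv ^^ j) f -` Qbar \<subseteq> Qbar"
    "\<And>n. f \<noteq> g n"
proof -
  obtain m :: "nat \<Rightarrow> complex poly" where m: "range m = {p. rational_poly p \<and> p \<noteq> 0}"
    using nonzero_rational_polys_sequence by blast
  have m': "\<And>k. rational_poly (m k) \<and> m k \<noteq> 0"
    using m by blast
  obtain F \<D> where
    F: "\<And>n. rational_poly (F n)" "\<And>n. n < degree (F n)" "\<And>n. degree (F n) < degree (F (Suc n))"
    "\<And>n i. i \<le> degree (F n) \<Longrightarrow> coeff (F (Suc n)) i = coeff (F n) i"
    "\<And>n. lead_coeff (F (Suc n)) \<noteq> (deriv ^^ (degree (F (Suc n)))) (g n) 0 / fact (degree (F (Suc n)))"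
    and D: "\<And>n. \<D> n \<subseteq> \<D> (Suc n)" "1 \<in> \<D> 0"
    "\<And>n k. k \<le> n \<Longrightarrow> m k \<in> \<D> n"
    "\<And>n j k. j \<le> n \<Longrightarrow> k \<le> n \<Longrightarrow> pcompose (m k) ((pderiv ^^ j) (F n)) \<in> \<D> n"
    "\<And>n d j z. d \<in> \<D> n \<Longrightarrow> j \<le> n \<Longrightarrow> norm z \<le> real n \<Longrightarrow>
      norm (poly ((pderiv ^^ j) (F (Suc n))) z - poly ((pderiv ^^ j) (F n)) z)
        \<le> (1/2) ^ Suc n * norm (poly d z)"
  proof (rule constrained_polynomial_sequence[where m = m and b = "\<lambda>n h. (deriv ^^ h) (g n) 0 / fact h",
      OF m'], goal_cases)
    case (1 F \<D>)
    show ?thesis by (rule that[of F \<D>]; fact 1)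
  qed
  obtain f where f: "f holomorphic_on UNIV"
    "\<And>j z. (\<lambda>n. poly ((pderiv ^^ j) (F n)) z) \<longlonglongrightarrow> (deriv ^^ j) f z"
    "\<And>n d j z. d \<in> \<D> n \<Longrightarrow> j \<le> n \<Longrightarrow> norm z \<le> real n \<Longrightarrow>
      norm ((deriv ^^ j) f z - poly ((pderiv ^^ j) (F n)) z) \<le> (1/2) ^ n * norm (poly d z)"
  proof (rule entire_limit_of_controlled_polynomials[where F = F, OF D(1,2)], goal_cases)
    case (1 n d j z)
    show ?case by (rule D(5)) (fact 1)+
  next
    case (2 f)
    show ?thesis by (rule that[of f]; fact 2)
  qed
  have mono_degree: "degree (F n) \<le> degree (F k)" if "n \<le> k" for n k
    using lift_Suc_mono_le[of "\<lambda>n. degree (F n)"] F(3) that less_imp_le by blast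
  have stable: "coeff (F k) i = coeff (F n) i" if "n \<le> k" "i \<le> degree (F n)" for n k i
    using that(1)
  proof (induction k rule: dec_induct)
    case (step k)
    then show ?case
      using F(4)[of i k] mono_degree[of n k] that(2) by simp
  qed simp
  have taylor: "(deriv ^^ i) f 0 / fact i = coeff (F n) i" if "i \<le> degree (F n)" for i n
  proof -
    have "eventually (\<lambda>k. poly ((pderiv ^^ i) (F k)) 0 = fact i * coeff (F n) i) sequentially"
      using eventually_ge_at_top[of n]
      by eventually_elim (simp add: poly_higher_pderiv_0 stable that)
    from LIMSEQ_unique[OF f(2)[of i 0] tendsto_eventually[OF this]] show ?thesis by simp
  qed
  have annihilator: "\<exists>k. poly (m k) x = 0" if x: "algebraic x" for x
  proof -
    obtain p where p: "rational_poly p" "p \<noteq> 0" "poly p x = 0"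
      using x by (auto simp: algebraic_iff_rational_poly)
    then have "p \<in> range m"
      using m by simp
    with p(3) show ?thesis
      by auto
  qed
  have large: "eventually (\<lambda>n. j \<le> n \<and> k \<le> n \<and> norm z \<le> real n) sequentially" for j k and z :: complex
    using filterlim_real_sequentially
    by (intro eventually_conj eventually_ge_at_top) (simp add: filterlim_at_top)
  show ?thesis
  proof (rule that[of f])
    show "f holomorphic_on UNIV" by fact
    show "(deriv ^^ h) f 0 / fact h \<in> \<rat>" for h
      using taylor[of h h] F(1,2)[of h] by (simp add: rational_poly_def less_imp_le)
    show "transcendental_on f UNIV"
    proof (rule entire_not_polynomial_imp_transcendental[OF f(1)])
      fix N
      have "lead_coeff (F N) \<noteq> 0"
        using F(2)[of N] by auto
      then have "(deriv ^^ degree (F N)) f 0 \<noteq> 0"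
        using taylor[of "degree (F N)" N] by auto
      then show "\<exists>h>N. (deriv ^^ h) f 0 \<noteq> 0"
        using F(2) by blast
    qed
    show "f \<noteq> g n" for n
      using taylor[of "degree (F (Suc n))" "Suc n"] F(5)[of n] by auto
    show "(deriv ^^ j) f ` Qbar \<subseteq> Qbar" for j
    proof (clarsimp simp: Qbar_def)
      fix \<alpha> :: complex assume \<alpha>: "algebraic \<alpha>"
      then obtain k where k: "poly (m k) \<alpha> = 0"
        using annihilator by blast
      obtain n where n: "j \<le> n" "k \<le> n" "norm \<alpha> \<le> real n"
        using eventually_happens[OF large[of j k \<alpha>]] by auto
      have "(deriv ^^ j) f \<alpha> = poly ((pderiv ^^ j) (F n)) \<alpha>"
        using f(3)[OF D(3)[OF n(2)] n(1,3)] k by simp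
      then show "algebraic ((deriv ^^ j) f \<alpha>)"
        using algebraic_poly[OF rational_poly_higher_pderiv[OF F(1)] \<alpha>] by simp
    qed
    show "(deriv ^^ j) f -` Qbar \<subseteq> Qbar" for j
    proof (clarsimp simp: Qbar_def)
      fix z assume "algebraic ((deriv ^^ j) f z)"
      then obtain k where k: "poly (m k) ((deriv ^^ j) f z) = 0"
        using annihilator by blast
      have "eventually (\<lambda>n. norm ((deriv ^^ j) f z - poly ((pderiv ^^ j) (F n)) z)
          \<le> (1/2) ^ n * norm (poly (m k) (poly ((pderiv ^^ j) (F n)) z))) sequentially"
        using large[of j k z]
      proof eventually_elim
        case (elim n)
        then show ?case
          using f(3)[OF D(4)[of j n k], of j z] by (simp add: poly_pcompose)
      qed
      then have "eventually (\<lambda>n. poly (m k) (poly ((pderiv ^^ j) (F n)) z) = 0) sequentially"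
        by (rule root_of_approximant[OF k f(2)])
      from eventually_happens[OF eventually_conj[OF eventually_ge_at_top[of j] this]]
      obtain n where n: "j \<le> n" "poly (pcompose (m k) ((pderiv ^^ j) (F n))) z = 0"
        by (auto simp: poly_pcompose)
      have "rational_poly (m k)" "m k \<noteq> 0"
        using m by blast+
      then have "rational_poly (pcompose (m k) ((pderiv ^^ j) (F n)))"
        by (intro rational_poly_pcompose rational_poly_higher_pderiv F)
      moreover have "pcompose (m k) ((pderiv ^^ j) (F n)) \<noteq> 0"
        using F(2)[of n] n(1) \<open>m k \<noteq> 0\<close> by (simp add: pcompose_eq_0_iff degree_higher_pderiv)
      ultimately show "algebraic z"
        using n(2) algebraic_iff_rational_poly by blast
    qed
  qed
qed

theorem theorem1p2:
  shows "uncountable {f :: complex \<Rightarrow> complex.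
    f holomorphic_on UNIV \<and>
    transcendental_on f UNIV \<and>
    (\<exists>c :: nat \<Rightarrow> complex. (\<forall>h. c h \<in> \<rat>) \<and> (\<forall>z. (\<lambda>h. c h * z ^ h) sums f z)) \<and>
    (\<forall>j. (deriv ^^ j) f ` Qbar \<subseteq> Qbar \<and> (deriv ^^ j) f -` Qbar \<subseteq> Qbar)}"
    (is "uncountable ?S")
proof
  assume "countable ?S"
  obtain f where f: "f holomorphic_on UNIV" "transcendental_on f UNIV"
    "\<And>h. (deriv ^^ h) f 0 / fact h \<in> \<rat>"
    "\<And>j. (deriv ^^ j) f ` Qbar \<subseteq> Qbar" "\<And>j. (deriv ^^ j) f -` Qbar \<subseteq> Qbar"
    "\<And>n. f \<noteq> from_nat_into ?S n"
  proof (rule entire_function_outside_sequence[of "from_nat_into ?S"], goal_cases)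
    case (1 f)
    show ?thesis by (rule that[of f]; fact 1)
  qed
  have "(\<lambda>h. (deriv ^^ h) f 0 / fact h * z ^ h) sums f z" for z
    using holomorphic_power_series[of f 0 "norm z + 1" z] f(1)
    by (auto intro: holomorphic_on_subset)
  then have "\<exists>c :: nat \<Rightarrow> complex. (\<forall>h. c h \<in> \<rat>) \<and> (\<forall>z. (\<lambda>h. c h * z ^ h) sums f z)"
    using f(3) by (intro exI[of _ "\<lambda>h. (deriv ^^ h) f 0 / fact h"]) simp
  then have "f \<in> ?S"
    using f(1,2,4,5) by simp
  from from_nat_into_surj[OF \<open>countable ?S\<close> this] obtain n where "from_nat_into ?S n = f" ..
  with f(6)[of n] show False
    by (rule notE[OF _ sym])
qed

end
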